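(* Let $G$ be a finite group and let $M_0, M_1, \dots, M_r$ be the maximal subgroups of $G$ (all of them, listed without repetition). Then $$sd(G)=\frac{1}{|L(G)|}\left(1+\sum_{s=0}^{r}(-1)^s\sum_{0\le i_0<i_1<\dots<i_s\le r}\Big|L\Big(\bigcap_{j=0}^{s}M_{i_j}\Big)\Big|\; sd\Big(\bigcap_{j=0}^{s}M_{i_j},\,G\Big)\right).$$
   Context: For a finite group $X$, $L(X)$ denotes the set (lattice) of all subgroups of $X$, including the trivial subgroup and $X$ itself. For subsets $A,B$ of a group, $AB=\{ab \mid a\in A, b\in B\}$; two subgroups $A,B$ commute (permute) if $AB=BA$. For subgroups $H,K$ of a finite group $G$, the relative subgroup commutativity degree of $H$ and $K$ is $$sd(H,K)=\frac{1}{|L(H)||L(K)|}\left|\{(H_1,K_1)\in L(H)\times L(K)\mid H_1K_1=K_1H_1\}\right|.$$ In particular (taking $K=G$) $sd(H,G)$ is the relative subgroup commutativity degree of the subgroup $H$ of $G$, and the subgroup commutativity degree of $G$ is $$sd(G)=sd(G,G)=\frac{1}{|L(G)|^2}\left|\{(H,K)\in L(G)^2\mid HK=KH\}\right|.$$ *)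

theory Defs
  imports Complex_Main "HOL-Algebra.Coset"
begin

definition subgroup_lattice :: "('a, 'b) monoid_scheme \<Rightarrow> 'a set set" where
  "subgroup_lattice X = {H. subgroup H X}"

text \<open>\<open>H\<close> and \<open>K\<close> are subsets of the carrier of \<open>G\<close> (subgroups in all uses), each turned into a
  group of its own by restricting the carrier of \<open>G\<close>.\<close>

definition rel_subgroup_comm_degree ::
    "('a, 'b) monoid_scheme \<Rightarrow> 'a set \<Rightarrow> 'a set \<Rightarrow> real" where
  "rel_subgroup_comm_degree G H K =
     real (card {(H1, K1). H1 \<in> subgroup_lattice (G\<lparr>carrier := H\<rparr>) \<and>
                           K1 \<in> subgroup_lattice (G\<lparr>carrier := K\<rparr>) \<and>
                           H1 <#>\<^bsub>G\<^esub> K1 = K1 <#>\<^bsub>G\<^esub> H1}) /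
     (real (card (subgroup_lattice (G\<lparr>carrier := H\<rparr>))) *
      real (card (subgroup_lattice (G\<lparr>carrier := K\<rparr>))))"

definition subgroup_comm_degree :: "('a, 'b) monoid_scheme \<Rightarrow> real" where
  "subgroup_comm_degree G = rel_subgroup_comm_degree G (carrier G) (carrier G)"

definition maximal_subgroup :: "'a set \<Rightarrow> ('a, 'b) monoid_scheme \<Rightarrow> bool" where
  "maximal_subgroup M G \<longleftrightarrow>
     subgroup M G \<and> M \<noteq> carrier G \<and>
     (\<forall>H. subgroup H G \<and> M \<subseteq> H \<longrightarrow> H = M \<or> H = carrier G)"

text \<open>The index tuples \<open>i\<^sub>0 < i\<^sub>1 < \<dots> < i\<^sub>s\<close> with entries in \<open>{0, \<dots>, n - 1}\<close>, as lists of
  length \<open>s + 1\<close>.\<close>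

definition increasing_tuples :: "nat \<Rightarrow> nat \<Rightarrow> nat list set" where
  "increasing_tuples n s =
     {i. length i = s + 1 \<and> sorted_wrt (<) i \<and> set i \<subseteq> {..<n}}"

end

theory Submission
  imports Defs
begin

text \<open>
  Clearing denominators, the claim counts pairs. For a subgroup \<open>H\<close> of \<open>G\<close> let \<open>P(H)\<close> be the set
  of pairs of permuting subgroups of \<open>G\<close> whose first entry lies in \<open>H\<close>; then
  \<open>|L(H)| * sd(H, G) = |P(H)| / |L(G)|\<close> (\<open>card_times_rel_degree\<close>), and the case \<open>H = G\<close> computes
  \<open>sd(G)\<close>. A subgroup of a finite group is either the whole group, which permutes with each of the
  \<open>|L(G)|\<close> subgroups, or it lies in some maximal subgroup. Hence
  \<open>|P(G)| = |L(G)| + |P(M\<^sub>0) \<union> \<dots> \<union> P(M\<^sub>r)|\<close> (\<open>card_permuting_pairs_carrier\<close>).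

  As \<open>P\<close> turns intersections of subgroups into intersections of sets of pairs, the cardinality of
  the union is given by inclusion-exclusion, with the sets of indices written as increasing tuples
  (\<open>inclusion_exclusion_increasing_tuples\<close>). Dividing by \<open>|L(G)|\<^sup>2\<close> gives the formula; the summand
  \<open>1\<close> is the contribution of the pairs with first entry \<open>G\<close>.
\<close>

section \<open>Inclusion-exclusion over increasing tuples\<close>

text \<open>A tuple is the same thing as its set of entries, since a finite set of numbers has exactly
  one increasing enumeration.\<close>

lemma bij_betw_set_increasing_tuples:
  "bij_betw set (increasing_tuples n s) {B. B \<subseteq> {..<n} \<and> card B = Suc s}"
proof (rule bij_betw_byWitness[where f' = sorted_list_of_set])
  have fin: "finite B" if "B \<subseteq> {..<n}" for B
    using that by (rule finite_subset) simp
  show "\<forall>i\<in>increasing_tuples n s. sorted_list_of_set (set i) = i"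
    by (auto simp: increasing_tuples_def strict_sorted_iff sorted_list_of_set.idem_if_sorted_distinct)
  show "\<forall>B\<in>{B. B \<subseteq> {..<n} \<and> card B = Suc s}. set (sorted_list_of_set B) = B"
    using fin by simp
  show "set ` increasing_tuples n s \<subseteq> {B. B \<subseteq> {..<n} \<and> card B = Suc s}"
    by (auto simp: increasing_tuples_def strict_sorted_iff distinct_card)
  show "sorted_list_of_set ` {B. B \<subseteq> {..<n} \<and> card B = Suc s} \<subseteq> increasing_tuples n s"
    using fin by (auto simp: increasing_tuples_def)
qed

lemma image_nth_increasing_tuple:
  assumes "i \<in> increasing_tuples n s"
  shows "(!) i ` {0..s} = set i"
proof -
  have "{0..s} = {..<length i}"
    using assms by (auto simp: increasing_tuples_def)
  then show ?thesis
    by (auto simp: set_conv_nth)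
qed

text \<open>Inclusion-exclusion is a sum over all nonempty sets of indices; those with \<open>s + 1\<close> elements
  are collected into the summand \<open>s\<close> and then replaced by their increasing enumerations. Since the
  sum runs over sets of indices, members of the family may coincide.\<close>

lemma inclusion_exclusion_increasing_tuples:
  fixes X :: "nat \<Rightarrow> 'c set"
  assumes fin: "\<And>j. j < n \<Longrightarrow> finite (X j)"
  shows "real (card (\<Union>j<n. X j)) =
    (\<Sum>s<n. (-1) ^ s * (\<Sum>i\<in>increasing_tuples n s. real (card (\<Inter>j\<in>{0..s}. X (i ! j)))))"
proof -
  interpret Incl_Excl finite "\<lambda>S. real (card S) :: real"
    by unfold_locales (auto simp: card_Un_disjnt)
  define F where "F B = (-1) ^ (card B + 1) * real (card (\<Inter>(X ` B)))" for B
  let ?S = "{B. B \<subseteq> {..<n} \<and> B \<noteq> {}}"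
  have "real (card (\<Union>j<n. X j)) = (\<Sum>B\<in>?S. F B)"
    unfolding F_def using fin by (intro restricted_indexed) auto
  also have "\<dots> = (\<Sum>s<n. \<Sum>B\<in>{B\<in>?S. card B - 1 = s}. F B)"
  proof (rule sum.group[symmetric])
    show "(\<lambda>B. card B - 1) ` ?S \<subseteq> {..<n}"
    proof (rule image_subsetI)
      fix B assume "B \<in> ?S"
      then have B: "B \<subseteq> {..<n}" "B \<noteq> {}" by auto
      then have "card B \<le> n" "card B > 0"
        using card_mono[of "{..<n}" B] by (auto simp: card_gt_0_iff intro: finite_subset[OF _ finite_lessThan])
      then show "card B - 1 \<in> {..<n}" by auto
    qed
  qed auto
  also have "\<dots> = (\<Sum>s<n. \<Sum>B | B \<subseteq> {..<n} \<and> card B = Suc s. F B)"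
  proof (intro sum.cong refl)
    fix s
    have "B \<noteq> {} \<and> card B - 1 = s \<longleftrightarrow> card B = Suc s" if "B \<subseteq> {..<n}" for B
    proof -
      have "finite B"
        using that by (rule finite_subset) simp
      then have "B = {} \<longleftrightarrow> card B = 0"
        by simp
      then show ?thesis
        by arith
    qed
    then show "{B\<in>?S. card B - 1 = s} = {B. B \<subseteq> {..<n} \<and> card B = Suc s}"
      by blast
  qed
  also have "\<dots> = (\<Sum>s<n. (-1) ^ s *
      (\<Sum>i\<in>increasing_tuples n s. real (card (\<Inter>j\<in>{0..s}. X (i ! j)))))"
  proof (intro sum.cong refl)
    fix s
    have "F (set i) = (-1) ^ s * real (card (\<Inter>j\<in>{0..s}. X (i ! j)))"
      if i: "i \<in> increasing_tuples n s" for i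
    proof -
      have "card (set i) = Suc s"
        using bij_betw_apply[OF bij_betw_set_increasing_tuples i] by simp
      moreover have "(\<lambda>j. X (i ! j)) ` {0..s} = X ` set i"
        unfolding image_nth_increasing_tuple[OF i, symmetric] by (simp add: image_image)
      ultimately show ?thesis
        unfolding F_def by simp
    qed
    then show "(\<Sum>B | B \<subseteq> {..<n} \<and> card B = Suc s. F B) = (-1) ^ s *
        (\<Sum>i\<in>increasing_tuples n s. real (card (\<Inter>j\<in>{0..s}. X (i ! j))))"
      unfolding sum_distrib_left
      by (subst sum.reindex_bij_betw[OF bij_betw_set_increasing_tuples, symmetric])
        (rule sum.cong, auto)
  qed
  finally show ?thesis .
qed

section \<open>Pairs of permuting subgroups\<close>

text \<open>The first entries are subgroups of \<open>G\<close> contained in \<open>H\<close>, rather than subgroups of the group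
  \<open>H\<close>, so that intersecting the sets \<open>H\<close> visibly intersects the sets of pairs.\<close>

definition permuting_pairs :: "('a, 'b) monoid_scheme \<Rightarrow> 'a set \<Rightarrow> ('a set \<times> 'a set) set" where
  "permuting_pairs G H =
     {(H1, K1). subgroup H1 G \<and> H1 \<subseteq> H \<and> subgroup K1 G \<and> H1 <#>\<^bsub>G\<^esub> K1 = K1 <#>\<^bsub>G\<^esub> H1}"

lemma permuting_pairs_INT:
  assumes "J \<noteq> {}"
  shows "permuting_pairs G (\<Inter>j\<in>J. M j) = (\<Inter>j\<in>J. permuting_pairs G (M j))"
  using assms by (auto simp: permuting_pairs_def)

lemma finite_subgroup_lattice:
  assumes "finite (carrier G)"
  shows "finite (subgroup_lattice G)"
  by (rule finite_subset[of _ "Pow (carrier G)"])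
    (use assms in \<open>auto simp: subgroup_lattice_def dest: subgroup.subset\<close>)

lemma finite_permuting_pairs:
  assumes "finite (carrier G)"
  shows "finite (permuting_pairs G H)"
  by (rule finite_subset[of _ "subgroup_lattice G \<times> subgroup_lattice G"])
    (use finite_subgroup_lattice[OF assms] in \<open>auto simp: subgroup_lattice_def permuting_pairs_def\<close>)

context group
begin

lemma subgroup_lattice_restrict:
  assumes "subgroup H G"
  shows "subgroup_lattice (G\<lparr>carrier := H\<rparr>) = {K. subgroup K G \<and> K \<subseteq> H}"
  unfolding subgroup_lattice_def
  using incl_subgroup[OF assms] subgroup_incl[OF _ assms] subgroup.subset[of _ "G\<lparr>carrier := H\<rparr>"]
  by simp blast

lemma card_subgroup_lattice_pos:
  assumes "finite (carrier G)"
  shows "card (subgroup_lattice G) > 0"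
  using finite_subgroup_lattice[OF assms] subgroup_self
  by (auto simp: card_gt_0_iff subgroup_lattice_def)

text \<open>The factor \<open>|L(H)|\<close> cancels against the denominator of \<open>sd(H, G)\<close>, because it is nonzero:
  \<open>H\<close> is finite and is a subgroup of itself.\<close>

lemma card_times_rel_degree:
  assumes fin: "finite (carrier G)" and H: "subgroup H G"
  shows "real (card (subgroup_lattice (G\<lparr>carrier := H\<rparr>))) * rel_subgroup_comm_degree G H (carrier G)
    = real (card (permuting_pairs G H)) / real (card (subgroup_lattice G))"
proof -
  interpret H: group "G\<lparr>carrier := H\<rparr>"
    by (rule subgroup_imp_group[OF H])
  have "finite H"
    using fin H by (meson finite_subset subgroup.subset)
  then have "card (subgroup_lattice (G\<lparr>carrier := H\<rparr>)) > 0"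
    by (intro H.card_subgroup_lattice_pos) simp
  moreover have "{(H1, K1). H1 \<in> subgroup_lattice (G\<lparr>carrier := H\<rparr>) \<and>
      K1 \<in> subgroup_lattice (G\<lparr>carrier := carrier G\<rparr>) \<and> H1 <#> K1 = K1 <#> H1}
      = permuting_pairs G H"
    unfolding permuting_pairs_def subgroup_lattice_restrict[OF H]
    by (auto simp: subgroup_lattice_def)
  ultimately show ?thesis
    unfolding rel_subgroup_comm_degree_def by simp
qed

lemma carrier_permutes:
  assumes "subgroup K G"
  shows "carrier G <#> K = K <#> carrier G"
  using commut_normal[OF assms, of "carrier G"] subgroup_self by (simp add: normal_inv_iff)

text \<open>There are only finitely many proper subgroups, so one that is maximal for inclusion exists
  above \<open>H\<close>.\<close>

lemma proper_subgroup_le_maximal: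
  assumes fin: "finite (carrier G)" and H: "subgroup H G" "H \<noteq> carrier G"
  obtains M where "maximal_subgroup M G" "H \<subseteq> M"
proof -
  let ?A = "{K. subgroup K G \<and> K \<noteq> carrier G}"
  have "finite ?A"
    by (rule finite_subset[OF _ finite_subgroup_lattice[OF fin]]) (auto simp: subgroup_lattice_def)
  from finite_has_maximal2[OF this, of H] H
  obtain M where "M \<in> ?A" "H \<subseteq> M" "\<forall>K\<in>?A. M \<subseteq> K \<longrightarrow> M = K"
    by auto
  then show ?thesis
    by (intro that[of M]) (auto simp: maximal_subgroup_def)
qed

text \<open>The pairs are split by whether their first entry is all of \<open>G\<close>. If it is not, it lies in a
  maximal subgroup; and no maximal subgroup contains \<open>G\<close>, so the two kinds are disjoint.\<close>

lemma card_permuting_pairs_carrier: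
  assumes fin: "finite (carrier G)"
  shows "card (permuting_pairs G (carrier G)) =
    card (subgroup_lattice G) + card (\<Union>M\<in>{M. maximal_subgroup M G}. permuting_pairs G M)"
proof -
  let ?W = "{carrier G} \<times> subgroup_lattice G"
  let ?U = "\<Union>M\<in>{M. maximal_subgroup M G}. permuting_pairs G M"
  have split: "permuting_pairs G (carrier G) = ?W \<union> ?U"
  proof
    show "permuting_pairs G (carrier G) \<subseteq> ?W \<union> ?U"
    proof
      fix p assume p: "p \<in> permuting_pairs G (carrier G)"
      obtain H K where HK: "p = (H, K)" by (cases p)
      show "p \<in> ?W \<union> ?U"
      proof (cases "H = carrier G")
        case True
        then show ?thesis
          using p HK by (auto simp: permuting_pairs_def subgroup_lattice_def)
      next
        case False
        have "subgroup H G"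
          using p HK by (auto simp: permuting_pairs_def)
        from proper_subgroup_le_maximal[OF fin this False]
        obtain M where "maximal_subgroup M G" "H \<subseteq> M" .
        then show ?thesis
          using p HK by (auto simp: permuting_pairs_def)
      qed
    qed
    show "?W \<union> ?U \<subseteq> permuting_pairs G (carrier G)"
      using carrier_permutes subgroup_self
      by (auto simp: permuting_pairs_def subgroup_lattice_def dest: subgroup.subset)
  qed
  have "finite (?W \<union> ?U)"
    using finite_permuting_pairs[OF fin] by (simp only: split[symmetric])
  moreover have "?W \<inter> ?U = {}"
    by (auto simp: permuting_pairs_def maximal_subgroup_def dest: subgroup.subset)
  ultimately show ?thesis
    unfolding split by (subst card_Un_disjoint) (auto simp: card_cartesian_product)
qed

end

section \<open>The subgroup commutativity degree\<close>

theorem theorem2p4: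
  fixes G :: "('a, 'b) monoid_scheme" and M :: "nat \<Rightarrow> 'a set" and n :: nat
  assumes "group G" and "finite (carrier G)"
    and "bij_betw M {..<n} {A. maximal_subgroup A G}"
  shows "subgroup_comm_degree G =
    1 / real (card (subgroup_lattice G)) *
    (1 + (\<Sum>s<n. (-1) ^ s *
           (\<Sum>i\<in>increasing_tuples n s.
              real (card (subgroup_lattice (G\<lparr>carrier := (\<Inter>j\<in>{0..s}. M (i ! j))\<rparr>))) *
              rel_subgroup_comm_degree G (\<Inter>j\<in>{0..s}. M (i ! j)) (carrier G))))"
proof -
  interpret group G by fact
  note fin = \<open>finite (carrier G)\<close>
  let ?l = "real (card (subgroup_lattice G))"
  let ?I = "\<lambda>i s. \<Inter>j\<in>{0..s}. M (i ! j)"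
  let ?U = "\<Union>j<n. permuting_pairs G (M j)"
  have l: "?l > 0"
    using card_subgroup_lattice_pos[OF fin] by simp
  have max: "maximal_subgroup (M j) G" if "j < n" for j
    using bij_betw_apply[OF assms(3)] that by blast
  have summand: "real (card (subgroup_lattice (G\<lparr>carrier := ?I i s\<rparr>))) *
      rel_subgroup_comm_degree G (?I i s) (carrier G)
      = real (card (\<Inter>j\<in>{0..s}. permuting_pairs G (M (i ! j)))) / ?l"
    if i: "i \<in> increasing_tuples n s" for i s
  proof -
    have "subgroup (M (i ! j)) G" if "j \<in> {0..s}" for j
    proof -
      have "i ! j \<in> set i"
        using that image_nth_increasing_tuple[OF i] by blast
      then have "i ! j < n"
        using i by (auto simp: increasing_tuples_def)
      then show ?thesis
        using max by (simp add: maximal_subgroup_def)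
    qed
    then have "subgroup (?I i s) G"
      by (intro subgroups_Inter) auto
    then show ?thesis
      by (simp add: card_times_rel_degree[OF fin] permuting_pairs_INT)
  qed
  have "(\<Sum>s<n. (-1) ^ s * (\<Sum>i\<in>increasing_tuples n s.
          real (card (subgroup_lattice (G\<lparr>carrier := ?I i s\<rparr>))) *
          rel_subgroup_comm_degree G (?I i s) (carrier G)))
      = (\<Sum>s<n. (-1) ^ s * (\<Sum>i\<in>increasing_tuples n s.
          real (card (\<Inter>j\<in>{0..s}. permuting_pairs G (M (i ! j)))))) / ?l"
    by (simp add: summand flip: sum_divide_distrib)
  also have "\<dots> = real (card ?U) / ?l"
    by (simp add: inclusion_exclusion_increasing_tuples finite_permuting_pairs[OF fin])
  finally have sum: "(\<Sum>s<n. (-1) ^ s * (\<Sum>i\<in>increasing_tuples n s.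
          real (card (subgroup_lattice (G\<lparr>carrier := ?I i s\<rparr>))) *
          rel_subgroup_comm_degree G (?I i s) (carrier G))) = real (card ?U) / ?l" .
  have "?U = (\<Union>A\<in>{A. maximal_subgroup A G}. permuting_pairs G A)"
    unfolding bij_betw_imp_surj_on[OF assms(3), symmetric] by (simp add: image_image)
  then have "real (card (permuting_pairs G (carrier G))) = ?l + real (card ?U)"
    using card_permuting_pairs_carrier[OF fin] by simp
  then have "?l * subgroup_comm_degree G = (?l + real (card ?U)) / ?l"
    using card_times_rel_degree[OF fin subgroup_self] by (simp add: subgroup_comm_degree_def)
  also have "\<dots> = 1 + real (card ?U) / ?l"
    using l by (simp add: add_divide_distrib)
  finally have "subgroup_comm_degree G = 1 / ?l * (1 + real (card ?U) / ?l)"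
    using l by (simp add: eq_divide_eq mult.commute)
  then show ?thesis
    by (simp only: sum)
qed

end
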